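(* Let $n\ge 1$ and let $A$ be an $n\times n$ complex matrix. For all $1\le i,j\le n$, the $(j,i)$ entry of the adjugate matrix $\mathrm{adj}(A)$ is $$(\mathrm{adj}(A))_{ji}=\frac{(-1)^{\lfloor n/2\rfloor}}{(n-1)!}\ \hat e^{\,j}\cdot\Big(\big(S_{n-1}\circ (R_A)^{\otimes (n-1)}\circ T_1\big)(\hat e_i)\Big),$$ where $\hat e^{\,j}\cdot u$ denotes the $j$th coordinate of $u\in V$.
   Context: $V=\mathbb{C}^n$ is the space of column vectors with standard basis $\hat e_1,\dots,\hat e_n$, and $V^*$ is the space of row vectors of length $n$ with dual basis $\hat e^1,\dots,\hat e^n$. $R_A:V^*\to V^*$ denotes $w\mapsto wA$ (a matrix on a strand directed from top to bottom in a diagram). The adjugate is the transpose of the matrix of signed cofactors; equivalently $(\mathrm{adj}(A))_{ji}$ is the determinant of the matrix obtained from $A$ by replacing its $j$th column with $\hat e_i$. For $0\le k\le n$, $T_k:V^{\otimes k}\to (V^* )^{\otimes (n-k)}$ is the function of the trace diagram with a single sink vertex of degree $n$ with $k$ input strands below and $n-k$ output strands above (edges ordered counterclockwise starting from the left), i.e. the linear map $$T_k(v_1\otimes\cdots\otimes v_k)=\sum_{i_1,\dots,i_{n-k}=1}^n \det[v_1\ \cdots\ v_k\ \hat e_{i_{n-k}}\ \cdots\ \hat e_{i_1}]\ \hat e^{i_1}\otimes\cdots\otimes \hat e^{i_{n-k}}.$$ Likewise $S_k:(V^* )^{\otimes k}\to V^{\otimes (n-k)}$ is the function of the corresponding diagram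 with a source vertex: $$S_k(w_1\otimes\cdots\otimes w_k)=\sum_{i_1,\dots,i_{n-k}=1}^n \det\big(\text{matrix with rows } w_1,\dots,w_k,\hat e^{i_{n-k}},\dots,\hat e^{i_1}\big)\ \hat e_{i_1}\otimes\cdots\otimes \hat e_{i_{n-k}}.$$ Vertical stacking of diagrams is composition of functions. The right side involves the diagram in which $\hat e_i$ enters a sink vertex from below along an unlabelled strand, $n-1$ strands, each labelled $A$, run from a source vertex above down to the sink vertex, and the strand leaving the source vertex at the top is paired with $\hat e^{\,j}$. *)

theory Defs
  imports Complex_Main "Jordan_Normal_Form.Determinant"
begin

text \<open>
  Indices are counted from 0, so \<open>unit_vec n i\<close> with \<open>i < n\<close> stands for the \<open>(i+1)\<close>-st vector of the
  standard basis of \<open>V\<close> or of the dual basis of \<open>V\<^sup>*\<close>. Column vectors (elements of \<open>V\<close>) and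
  row vectors (elements of \<open>V\<^sup>*\<close>) are both elements of \<open>carrier_vec n\<close>.

  An element of the \<open>k\<close>-fold tensor power of either space is represented by its coordinate array with
  respect to the basis of pure tensors of basis vectors: the coefficient of the pure tensor of the
  basis vectors with indices \<open>i\<^sub>1, \<dots>, i\<^sub>k\<close> is the value at the list \<open>[i\<^sub>1, \<dots>, i\<^sub>k]\<close>. The array
  vanishes outside the lists of length \<open>k\<close> with entries below \<open>n\<close>. For \<open>k = 0\<close> the only such list is
  the empty one, so the tensor power is the field of scalars.
\<close>

type_synonym tensor = "nat list \<Rightarrow> complex"

definition multi_idx :: "nat \<Rightarrow> nat \<Rightarrow> nat list set" where
  "multi_idx n k = {js. length js = k \<and> set js \<subseteq> {..<n}}"

definition tensor_carrier :: "nat \<Rightarrow> nat \<Rightarrow> tensor set" where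
  "tensor_carrier n k = {t. \<forall>js. js \<notin> multi_idx n k \<longrightarrow> t js = 0}"

definition pure_tensor :: "nat \<Rightarrow> complex vec list \<Rightarrow> tensor" where
  "pure_tensor n vs = (\<lambda>js. if js \<in> multi_idx n (length vs)
     then (\<Prod>l<length vs. vs ! l $ (js ! l)) else 0)"

abbreviation basis_tensor :: "nat \<Rightarrow> nat list \<Rightarrow> tensor" where
  "basis_tensor n js \<equiv> pure_tensor n (map (unit_vec n) js)"

text \<open>
  The linear map on the \<open>k\<close>-th tensor power that takes the values prescribed by \<open>F\<close> on pure tensors
  of basis vectors. If \<open>F\<close> is multilinear, the value on every pure tensor is given by \<open>F\<close> (see the
  lemmas \<open>T_map_pure\<close>, \<open>S_map_pure\<close> and \<open>tensor_power_map_pure\<close>).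
\<close>

definition linear_extension ::
    "nat \<Rightarrow> nat \<Rightarrow> (complex vec list \<Rightarrow> tensor) \<Rightarrow> tensor \<Rightarrow> tensor" where
  "linear_extension n k F t =
     (\<lambda>is. \<Sum>js\<in>multi_idx n k. t js * F (map (unit_vec n) js) is)"

definition tensor_power_map ::
    "nat \<Rightarrow> nat \<Rightarrow> (complex vec \<Rightarrow> complex vec) \<Rightarrow> tensor \<Rightarrow> tensor" where
  "tensor_power_map n k f = linear_extension n k (\<lambda>vs. pure_tensor n (map f vs))"

text \<open>
  The functions of the diagrams with a single sink (\<open>T_map\<close>) or source (\<open>S_map\<close>) vertex of degree
  \<open>n\<close> with \<open>k\<close> inputs and \<open>n - k\<close> outputs; meaningful only for \<open>k \<le> n\<close>. The output strands enter the
  determinant in reverse order because edges are read counterclockwise around the vertex.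
\<close>

definition T_map :: "nat \<Rightarrow> nat \<Rightarrow> tensor \<Rightarrow> tensor" where
  "T_map n k = linear_extension n k (\<lambda>vs js.
     \<Sum>is\<in>multi_idx n (n - k).
       det (mat_of_cols n (vs @ map (unit_vec n) (rev is))) * basis_tensor n is js)"

definition S_map :: "nat \<Rightarrow> nat \<Rightarrow> tensor \<Rightarrow> tensor" where
  "S_map n k = linear_extension n k (\<lambda>ws js.
     \<Sum>is\<in>multi_idx n (n - k).
       det (mat_of_rows n (ws @ map (unit_vec n) (rev is))) * basis_tensor n is js)"

text \<open>Multiplication of a row vector \<open>w\<close> by \<open>A\<close> from the right, \<open>w \<mapsto> w A\<close>.\<close>

definition R_map :: "complex mat \<Rightarrow> complex vec \<Rightarrow> complex vec" where
  "R_map A w = vec (dim_col A) (\<lambda>j. w \<bullet> col A j)"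

text \<open>The identification of the first tensor power with the vector space itself.\<close>

definition vec_of_tensor :: "nat \<Rightarrow> tensor \<Rightarrow> complex vec" where
  "vec_of_tensor n t = vec n (\<lambda>j. t [j])"


lemma finite_multi_idx [simp]: "finite (multi_idx n k)"
  unfolding multi_idx_def using finite_lists_length_eq[of "{..<n}" k]
  by (simp add: conj_commute)

lemma multi_idx_0 [simp]: "multi_idx n 0 = {[]}"
  by (auto simp: multi_idx_def)

lemma sum_multi_idx_Suc:
  "(\<Sum>js\<in>multi_idx n (Suc k). g js) = (\<Sum>j<n. \<Sum>js\<in>multi_idx n k. g (j # js))"
proof -
  have "multi_idx n (Suc k) = (\<lambda>(j, js). j # js) ` ({..<n} \<times> multi_idx n k)"
    by (auto simp: multi_idx_def image_iff length_Suc_conv)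
  moreover have "inj_on (\<lambda>(j, js). j # js) ({..<n} \<times> multi_idx n k)"
    by (auto simp: inj_on_def)
  ultimately show ?thesis
    by (simp add: sum.reindex sum.cartesian_product case_prod_unfold)
qed

lemma vec_of_tensor_pure:
  "v \<in> carrier_vec n \<Longrightarrow> vec_of_tensor n (pure_tensor n [v]) = v"
  by (intro eq_vecI) (auto simp: vec_of_tensor_def pure_tensor_def multi_idx_def)

lemma basis_tensor_apply:
  assumes "is \<in> multi_idx n k" and "js \<in> multi_idx n k"
  shows "basis_tensor n is js = (if is = js then 1 else 0)"
proof -
  have len: "length is = k" "length js = k" and lt: "\<And>l. l < k \<Longrightarrow> is ! l < n \<and> js ! l < n"
    using assms by (auto simp: multi_idx_def subset_iff)
  have "basis_tensor n is js = (\<Prod>l<k. if is ! l = js ! l then 1 else 0)"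
    using assms len lt by (auto simp: pure_tensor_def unit_vec_def intro!: prod.cong)
  also have "\<dots> = (if is = js then 1 else 0)"
    using len by (auto simp: list_eq_iff_nth_eq)
  finally show ?thesis .
qed

lemma tensor_basis_expansion:
  assumes t: "t \<in> tensor_carrier n k"
  shows "t = (\<lambda>js. \<Sum>is\<in>multi_idx n k. t is * basis_tensor n is js)"
proof
  fix js
  show "t js = (\<Sum>is\<in>multi_idx n k. t is * basis_tensor n is js)"
  proof (cases "js \<in> multi_idx n k")
    case True
    have "(\<Sum>is\<in>multi_idx n k. t is * basis_tensor n is js)
        = (\<Sum>is\<in>multi_idx n k. if is = js then t is else 0)"
      using True by (intro sum.cong) (auto simp: basis_tensor_apply)
    then show ?thesis using True by simp
  next
    case False
    have "basis_tensor n is js = 0" if "is \<in> multi_idx n k" for "is"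
      using False that by (auto simp: pure_tensor_def multi_idx_def split: if_splits)
    with False t show ?thesis by (simp add: tensor_carrier_def)
  qed
qed

lemma linear_extension_linear:
  "linear_extension n k F (\<lambda>js. a * s js + b * t js)
     = (\<lambda>is. a * linear_extension n k F s is + b * linear_extension n k F t is)"
  by (simp add: linear_extension_def sum.distrib sum_distrib_left algebra_simps)

lemma T_map_carrier: "T_map n k t \<in> tensor_carrier n (n - k)"
  unfolding tensor_carrier_def T_map_def linear_extension_def mem_Collect_eq
  by (intro allI impI sum.neutral ballI)
     (auto intro!: sum.neutral simp: pure_tensor_def multi_idx_def split: if_splits)

lemma S_map_carrier: "S_map n k t \<in> tensor_carrier n (n - k)"
  unfolding tensor_carrier_def S_map_def linear_extension_def mem_Collect_eq
  by (intro allI impI sum.neutral ballI)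
     (auto intro!: sum.neutral simp: pure_tensor_def multi_idx_def split: if_splits)

lemma multilinear_expansion:
  fixes F :: "complex vec list \<Rightarrow> complex"
  assumes F: "\<And>us v ws. length us + length ws + 1 = k \<Longrightarrow> v \<in> carrier_vec n \<Longrightarrow>
      F (us @ v # ws) = (\<Sum>j<n. v $ j * F (us @ unit_vec n j # ws))"
    and "length us + length vs = k" and "set vs \<subseteq> carrier_vec n"
  shows "F (us @ vs) = (\<Sum>js\<in>multi_idx n (length vs).
           (\<Prod>l<length vs. vs ! l $ (js ! l)) * F (us @ map (unit_vec n) js))"
  using assms(2,3)
proof (induction vs arbitrary: us)
  case Nil
  then show ?case by simp
next
  case (Cons v vs)
  have "F (us @ v # vs) = (\<Sum>j<n. v $ j * F ((us @ [unit_vec n j]) @ vs))"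
    using Cons.prems F[of us vs v] by simp
  also have "\<dots> = (\<Sum>j<n. v $ j * (\<Sum>js\<in>multi_idx n (length vs).
      (\<Prod>l<length vs. vs ! l $ (js ! l)) * F ((us @ [unit_vec n j]) @ map (unit_vec n) js)))"
    using Cons.prems by (subst Cons.IH) auto
  finally show ?case
    by (simp add: sum_multi_idx_Suc prod.lessThan_Suc_shift sum_distrib_left mult.assoc
        del: prod.lessThan_Suc)
qed

lemma linear_extension_pure:
  assumes F: "\<And>x us v ws. length us + length ws + 1 = k \<Longrightarrow> v \<in> carrier_vec n \<Longrightarrow>
      F (us @ v # ws) x = (\<Sum>j<n. v $ j * F (us @ unit_vec n j # ws) x)"
    and len: "length vs = k" and vs: "set vs \<subseteq> carrier_vec n"
  shows "linear_extension n k F (pure_tensor n vs) = F vs"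
proof
  fix x
  show "linear_extension n k F (pure_tensor n vs) x = F vs x"
    using multilinear_expansion[of k n "\<lambda>vs. F vs x" "[]" vs] F len vs
    by (simp add: linear_extension_def pure_tensor_def)
qed

lemma det_mat_of_cols_linear:
  fixes v :: "complex vec"
  assumes len: "length us + length ws + 1 = n" and v: "v \<in> carrier_vec n"
  shows "det (mat_of_cols n (us @ v # ws))
       = (\<Sum>j<n. v $ j * det (mat_of_cols n (us @ unit_vec n j # ws)))"
proof -
  let ?M = "\<lambda>u. mat_of_cols n (us @ u # ws)"
  let ?c = "length us"
  have c: "?c < n" using len by simp
  have carr: "?M u \<in> carrier_mat n n" for u
    using len by (simp add: mat_of_cols_def)
  have cof: "cofactor (?M u) i ?c = cofactor (?M v) i ?c" for u i
  proof -
    have "mat_delete (?M u) i ?c = mat_delete (?M v) i ?c"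
      using len by (intro eq_matI) (auto simp: mat_delete_def mat_of_cols_def nth_append)
    then show ?thesis by (simp add: cofactor_def)
  qed
  have exp: "det (?M u) = (\<Sum>i<n. u $ i * cofactor (?M v) i ?c)" for u
    using laplace_expansion_column[OF carr c, of u] c len
    by (simp add: cof[of u] mat_of_cols_index)
  have "det (?M (unit_vec n j)) = cofactor (?M v) j ?c" if "j < n" for j
  proof -
    have "det (?M (unit_vec n j)) = (\<Sum>i<n. if i = j then cofactor (?M v) i ?c else 0)"
      unfolding exp using that by (intro sum.cong) (auto simp: unit_vec_def)
    then show ?thesis using that by simp
  qed
  then show ?thesis by (simp add: exp[of v])
qed

lemma det_mat_of_rows_eq:
  "length vs = n \<Longrightarrow> det (mat_of_rows n vs :: complex mat) = det (mat_of_cols n vs)"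
proof -
  assume len: "length vs = n"
  have "mat_of_rows n vs = transpose_mat (mat_of_cols n vs)"
    using len by (intro eq_matI) (auto simp: mat_of_rows_def mat_of_cols_def)
  then show ?thesis
    using len by (simp add: det_transpose[of _ n] mat_of_cols_def)
qed

lemma T_map_pure:
  assumes "k \<le> n" and "length vs = k" and "set vs \<subseteq> carrier_vec n"
  shows "T_map n k (pure_tensor n vs) = (\<lambda>js. \<Sum>is\<in>multi_idx n (n - k).
           det (mat_of_cols n (vs @ map (unit_vec n) (rev is))) * basis_tensor n is js)"
  unfolding T_map_def
proof (rule linear_extension_pure)
  fix x and us ws :: "complex vec list" and v :: "complex vec"
  assume len: "length us + length ws + 1 = k" and v: "v \<in> carrier_vec n"
  let ?D = "\<lambda>u is. det (mat_of_cols n ((us @ u # ws) @ map (unit_vec n) (rev is)))"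
  have "?D v is = (\<Sum>j<n. v $ j * ?D (unit_vec n j) is)" if "is \<in> multi_idx n (n - k)" for "is"
    using det_mat_of_cols_linear[of us "ws @ map (unit_vec n) (rev is)" n v] that len v \<open>k \<le> n\<close>
    by (simp add: multi_idx_def)
  then have "(\<Sum>is\<in>multi_idx n (n - k). ?D v is * basis_tensor n is x)
      = (\<Sum>is\<in>multi_idx n (n - k). \<Sum>j<n. v $ j * (?D (unit_vec n j) is * basis_tensor n is x))"
    by (intro sum.cong) (simp_all add: sum_distrib_right mult.assoc)
  then show "(\<Sum>is\<in>multi_idx n (n - k). ?D v is * basis_tensor n is x)
      = (\<Sum>j<n. v $ j * (\<Sum>is\<in>multi_idx n (n - k). ?D (unit_vec n j) is * basis_tensor n is x))"
    by (subst (asm) sum.swap) (simp add: sum_distrib_left)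
qed (use assms in auto)

lemma S_map_pure:
  assumes "k \<le> n" and "length ws = k" and "set ws \<subseteq> carrier_vec n"
  shows "S_map n k (pure_tensor n ws) = (\<lambda>js. \<Sum>is\<in>multi_idx n (n - k).
           det (mat_of_rows n (ws @ map (unit_vec n) (rev is))) * basis_tensor n is js)"
proof -
  have det_eq: "det (mat_of_rows n (us @ map (unit_vec n) (rev is)))
      = det (mat_of_cols n (us @ map (unit_vec n) (rev is)) :: complex mat)"
    if "length us = k" "is \<in> multi_idx n (n - k)" for us "is"
    using that \<open>k \<le> n\<close> by (intro det_mat_of_rows_eq) (auto simp: multi_idx_def)
  have "S_map n k t = T_map n k t" for t
    unfolding S_map_def T_map_def linear_extension_def
    by (intro ext sum.cong refl arg_cong2[where f = "(*)"] det_eq) (auto simp: multi_idx_def)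
  then show ?thesis
    using T_map_pure[OF assms] det_eq[OF assms(2)] by simp
qed

lemma tensor_power_map_pure:
  assumes f: "\<And>v. v \<in> carrier_vec n \<Longrightarrow> f v \<in> carrier_vec n"
    and lin: "\<And>v i. v \<in> carrier_vec n \<Longrightarrow> i < n \<Longrightarrow>
      f v $ i = (\<Sum>j<n. v $ j * f (unit_vec n j) $ i)"
    and len: "length vs = k" and vs: "set vs \<subseteq> carrier_vec n"
  shows "tensor_power_map n k f (pure_tensor n vs) = pure_tensor n (map f vs)"
  unfolding tensor_power_map_def
proof (rule linear_extension_pure)
  fix x and us ws :: "complex vec list" and v :: "complex vec"
  assume len: "length us + length ws + 1 = k" and v: "v \<in> carrier_vec n"
  let ?P = "\<lambda>u. pure_tensor n (map f (us @ u # ws)) x"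
  let ?c = "length us"
  define R where "R = (\<Prod>l\<in>{..<k} - {?c}. map f (us @ v # ws) ! l $ (x ! l))"
  show "?P v = (\<Sum>j<n. v $ j * ?P (unit_vec n j))"
  proof (cases "x \<in> multi_idx n k")
    case True
    have c: "?c < k" using len by simp
    then have xc: "x ! ?c < n" using True by (auto simp: multi_idx_def subset_iff)
    have P: "?P u = f u $ (x ! ?c) * R" for u
    proof -
      have "?P u = (\<Prod>l<k. map f (us @ u # ws) ! l $ (x ! l))"
        using True len by (simp add: pure_tensor_def)
      also have "\<dots> = map f (us @ u # ws) ! ?c $ (x ! ?c)
          * (\<Prod>l\<in>{..<k} - {?c}. map f (us @ u # ws) ! l $ (x ! l))"
        using c by (intro prod.remove) auto
      also have "(\<Prod>l\<in>{..<k} - {?c}. map f (us @ u # ws) ! l $ (x ! l)) = R"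
        unfolding R_def by (intro prod.cong) (auto simp: nth_append nth_Cons')
      finally show ?thesis by (simp add: nth_append)
    qed
    show ?thesis
      unfolding P by (simp add: lin[OF v xc] sum_distrib_right mult.assoc)
  next
    case False
    then show ?thesis using len by (simp add: pure_tensor_def)
  qed
qed (use len vs in auto)

lemma tensor_power_map_R_map_pure:
  assumes A: "A \<in> carrier_mat n n" and "length vs = k" and "set vs \<subseteq> carrier_vec n"
  shows "tensor_power_map n k (R_map A) (pure_tensor n vs) = pure_tensor n (map (R_map A) vs)"
proof (rule tensor_power_map_pure)
  fix v :: "complex vec" and i
  assume v: "v \<in> carrier_vec n" and i: "i < n"
  have "R_map A (unit_vec n j) $ i = A $$ (j, i)" if "j < n" for j
    using A i that by (simp add: R_map_def scalar_prod_left_unit[of _ n])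
  then show "R_map A v $ i = (\<Sum>j<n. v $ j * R_map A (unit_vec n j) $ i)"
    using A v i by (simp add: R_map_def scalar_prod_def atLeast0LessThan)
qed (use assms in \<open>auto simp: R_map_def\<close>)

lemma adj_mat_eq_det_replace_col:
  assumes A: "(A :: complex mat) \<in> carrier_mat n n" and i: "i < n" and j: "j < n"
  shows "adj_mat A $$ (j, i)
       = det (mat n n (\<lambda>(r, c). if c = j then unit_vec n i $ r else A $$ (r, c)))"
    (is "_ = det ?B")
proof -
  have B: "?B \<in> carrier_mat n n" by simp
  have "mat_delete ?B l j = mat_delete A l j" for l
    using A j by (intro eq_matI) (auto simp: mat_delete_def)
  then have "det ?B = (\<Sum>l<n. unit_vec n i $ l * cofactor A l j)"
    using laplace_expansion_column[OF B j] A j by (simp add: cofactor_def)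
  also have "\<dots> = (\<Sum>l<n. if l = i then cofactor A l j else 0)"
    using i by (intro sum.cong) (auto simp: unit_vec_def)
  finally show ?thesis using A i j by (simp add: adj_mat_def)
qed

end

theory Submission
  imports Defs
begin

text \<open>
  By linearity the \<open>j\<close>-th coordinate of the image of \<open>e\<^sub>i\<close> is the sum over all index lists
  \<open>I\<close> of length \<open>n - 1\<close> of
  \<open>det [e\<^sub>i, e\<^sub>I reversed]\<close> times the determinant with rows \<open>e\<^sub>I A, e\<^sub>j\<close>. Reversing all \<open>n\<close> columns
  turns the first factor into \<open>(-1)\<close> to the power \<open>n div 2\<close> times \<open>\<epsilon> = det [e\<^sub>I, e\<^sub>i]\<close>. If \<open>\<epsilon> \<noteq> 0\<close>,
  then \<open>i\<close> does not occur in \<open>I\<close>, so the rows of the second matrix are rows of the matrix \<open>C\<close> obtained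
  from \<open>A\<close> by replacing row \<open>i\<close> with \<open>e\<^sub>j\<close>, and the second factor is \<open>\<epsilon> det C\<close>, where \<open>det C\<close> is
  the required entry of the adjugate. Finally \<open>\<epsilon>\<^sup>2 = 1\<close> for each of the \<open>(n - 1)!\<close> enumerations \<open>I\<close>
  of the indices different from \<open>i\<close>.
\<close>

lemma det_mat_of_rows_swap:
  fixes x y :: "'a :: comm_ring_1 vec"
  assumes "length us + length vs + length ws + 2 = n"
  shows "det (mat_of_rows n (us @ x # vs @ y # ws)) = - det (mat_of_rows n (us @ y # vs @ x # ws))"
proof -
  let ?k = "length us" and ?l = "length us + length vs + 1"
  let ?M = "mat_of_rows n (us @ y # vs @ x # ws)"
  have M: "?M \<in> carrier_mat n n"
    using assms by (auto simp: mat_of_rows_def)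
  have "mat_of_rows n (us @ x # vs @ y # ws) = swaprows ?k ?l ?M"
    using assms by (intro eq_matI) (auto simp: mat_of_rows_def nth_append nth_Cons')
  then show ?thesis
    using det_swaprows[OF _ _ _ M, of ?k ?l] assms by simp
qed

text \<open>Induction on the segment from outside in: exchanging its first and last rows costs one
  sign and leaves an inner segment shorter by two. The context \<open>us\<close>, \<open>ws\<close>
  is arbitrary because it absorbs the exchanged rows.\<close>

lemma det_mat_of_rows_rev_segment:
  fixes vs :: "'a :: comm_ring_1 vec list"
  assumes "length us + length vs + length ws = n"
  shows "det (mat_of_rows n (us @ rev vs @ ws))
    = (- 1) ^ (length vs div 2) * det (mat_of_rows n (us @ vs @ ws))"
  using assms
proof (induction "length vs" arbitrary: us vs ws rule: less_induct)
  case less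
  show ?case
  proof (cases "length vs < 2")
    case True
    then have "rev vs = vs"
      by (cases vs) auto
    with True show ?thesis by simp
  next
    case False
    then obtain x zs where "vs = x # zs" "zs \<noteq> []"
      by (cases vs) auto
    then obtain ms y where vs: "vs = x # ms @ [y]"
      by (cases zs rule: rev_cases) auto
    have "det (mat_of_rows n (us @ rev vs @ ws))
        = det (mat_of_rows n ((us @ [y]) @ rev ms @ (x # ws)))"
      by (simp add: vs)
    also have "\<dots> = (- 1) ^ (length ms div 2)
        * det (mat_of_rows n ((us @ [y]) @ ms @ (x # ws)))"
      using less.prems by (intro less.hyps) (auto simp: vs)
    also have "det (mat_of_rows n ((us @ [y]) @ ms @ (x # ws)))
        = - det (mat_of_rows n (us @ vs @ ws))"
      using det_mat_of_rows_swap[of us ms ws n y x] less.prems by (simp add: vs)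
    finally show ?thesis by (simp add: vs)
  qed
qed

lemma det_mat_of_rows_rev:
  fixes vs :: "'a :: comm_ring_1 vec list"
  assumes "length vs = n"
  shows "det (mat_of_rows n (rev vs)) = (- 1) ^ (n div 2) * det (mat_of_rows n vs)"
  using det_mat_of_rows_rev_segment[of "[]" vs "[]" n] assms by simp

text \<open>Row \<open>l\<close> of \<open>C\<close> is the product of the unit row vector
  \<open>l\<close> with \<open>C\<close>, so selecting rows is left multiplication by the matrix of
  unit rows.\<close>

lemma det_mat_of_rows_select:
  fixes C :: "'a :: comm_ring_1 mat"
  assumes C: "C \<in> carrier_mat n n" and len: "length js = n" and lt: "set js \<subseteq> {..<n}"
  shows "det (mat_of_rows n (map (row C) js))
    = det (mat_of_rows n (map (unit_vec n) js)) * det C"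
proof -
  have E: "mat_of_rows n (map (unit_vec n) js :: 'a vec list) \<in> carrier_mat n n"
    using len by (simp add: mat_of_rows_def)
  have "mat_of_rows n (map (row C) js) = mat_of_rows n (map (unit_vec n) js) * C"
  proof (rule eq_matI)
    fix r c
    assume "r < dim_row (mat_of_rows n (map (unit_vec n) js) * C)"
      and "c < dim_col (mat_of_rows n (map (unit_vec n) js) * C)"
    then have r: "r < n" and c: "c < n" using len C by auto
    then have "js ! r < n" using len lt by (auto simp: subset_iff)
    with r c show "mat_of_rows n (map (row C) js) $$ (r, c)
        = (mat_of_rows n (map (unit_vec n) js) * C) $$ (r, c)"
      using len C by (simp add: mat_of_rows_def scalar_prod_def unit_vec_def if_distrib[of "\<lambda>x. x * _"]
          cong: if_cong)
  qed (use len C in auto)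
  then show ?thesis by (simp add: det_mult[OF E C])
qed

lemma det_mat_of_rows_unit_vec_not_distinct:
  assumes len: "length js = n" and "\<not> distinct js"
  shows "det (mat_of_rows n (map (unit_vec n) js) :: 'a :: comm_ring_1 mat) = 0"
proof -
  let ?E = "mat_of_rows n (map (unit_vec n) js) :: 'a mat"
  have E: "?E \<in> carrier_mat n n"
    using len by (simp add: mat_of_rows_def)
  obtain r c where rc: "r < n" "c < n" "r \<noteq> c" "js ! r = js ! c"
    using assms by (auto simp: distinct_conv_nth)
  then have "row ?E r = row ?E c"
    using len by simp
  then show ?thesis
    using det_identical_rows[OF E] rc by blast
qed

text \<open>Distinct unit rows are orthonormal, so the matrix times its transpose is the identity;
  the sign of the permutation is never computed.\<close>

lemma det_mat_of_rows_unit_vec_square: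
  assumes len: "length js = n" and lt: "set js \<subseteq> {..<n}" and "distinct js"
  shows "(det (mat_of_rows n (map (unit_vec n) js) :: 'a :: comm_ring_1 mat))\<^sup>2 = 1"
proof -
  let ?E = "mat_of_rows n (map (unit_vec n) js) :: 'a mat"
  have E: "?E \<in> carrier_mat n n"
    using len by (simp add: mat_of_rows_def)
  have "?E * transpose_mat ?E = 1\<^sub>m n"
  proof (rule eq_matI)
    fix r c assume "r < dim_row (1\<^sub>m n :: 'a mat)" and "c < dim_col (1\<^sub>m n :: 'a mat)"
    then have r: "r < n" and c: "c < n" by auto
    then have "js ! r < n" "js ! c < n" "js ! r = js ! c \<longleftrightarrow> r = c"
      using assms by (auto simp: subset_iff nth_eq_iff_index_eq)
    with r c show "(?E * transpose_mat ?E) $$ (r, c) = 1\<^sub>m n $$ (r, c)"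
      using len by auto
  qed (use len in auto)
  then have "det ?E * det (transpose_mat ?E) = 1"
    using det_mult[OF E, of "transpose_mat ?E"] E by simp
  then show ?thesis
    by (simp add: det_transpose[OF E] power2_eq_square)
qed

lemma card_enumerations_remove:
  assumes "i < n"
  shows "card {is \<in> multi_idx n (n - 1). distinct (is @ [i])} = fact (n - 1)"
proof -
  \<comment> \<open>These lists enumerate an (n-1)-element set completely, so the falling product
    that counts them is the full factorial.\<close>
  have "{is \<in> multi_idx n (n - 1). distinct (is @ [i])}
      = {is. length is = n - 1 \<and> distinct is \<and> set is \<subseteq> {..<n} - {i}}"
    by (auto simp: multi_idx_def)
  moreover have "card ({..<n} - {i}) = n - 1"
    using assms by simp
  ultimately show ?thesis
    by (simp add: card_lists_distinct_length_eq fact_prod)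
qed

lemma linear_extension_sum:
  "linear_extension n k F (\<lambda>js. \<Sum>x\<in>X. a x * t x js) is
    = (\<Sum>x\<in>X. a x * linear_extension n k F (t x) is)"
  unfolding linear_extension_def sum_distrib_left sum_distrib_right
  by (subst sum.swap) (simp add: mult.assoc)

lemma sum_basis_tensor:
  assumes "js \<in> multi_idx n k"
  shows "(\<Sum>is\<in>multi_idx n k. a is * basis_tensor n is js) = a js"
proof -
  have "(\<Sum>is\<in>multi_idx n k. a is * basis_tensor n is js)
      = (\<Sum>is\<in>multi_idx n k. if is = js then a is else 0)"
    using assms by (intro sum.cong) (auto simp: basis_tensor_apply)
  with assms show ?thesis by simp
qed

lemma R_map_carrier: "A \<in> carrier_mat n n \<Longrightarrow> R_map A w \<in> carrier_vec n"
  by (auto simp: R_map_def)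

lemma R_map_unit_vec:
  assumes "A \<in> carrier_mat n n" and "l < n"
  shows "R_map A (unit_vec n l) = row A l"
  using assms by (intro eq_vecI) (auto simp: R_map_def scalar_prod_left_unit[of _ n])

lemma T_map_1_unit_vec_apply:
  assumes "i < n" and "is \<in> multi_idx n (n - 1)"
  shows "T_map n 1 (pure_tensor n [unit_vec n i]) is
    = (- 1) ^ (n div 2) * det (mat_of_rows n (map (unit_vec n) (is @ [i])))"
proof -
  have len: "length (map (unit_vec n) (is @ [i])) = n"
    using assms by (auto simp: multi_idx_def)
  have "T_map n 1 (pure_tensor n [unit_vec n i]) is
      = det (mat_of_cols n ([unit_vec n i] @ map (unit_vec n) (rev is)))"
    using assms by (subst T_map_pure) (simp_all add: sum_basis_tensor)
  \<comment> \<open>The output strands enter the determinant reversed and after the input, which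
    makes the column list exactly the reversal of \<open>is @ [i]\<close>.\<close>
  also have "\<dots> = det (mat_of_cols n (rev (map (unit_vec n) (is @ [i]))))"
    by (simp add: rev_map)
  also have "\<dots> = det (mat_of_rows n (rev (map (unit_vec n) (is @ [i]))))"
    by (rule det_mat_of_rows_eq[symmetric]) (use len in simp)
  finally show ?thesis
    by (subst (asm) det_mat_of_rows_rev[OF len]) auto
qed

lemma S_map_pure_apply_singleton:
  assumes "n \<ge> 1" and "j < n" and "length ws = n - 1" and "set ws \<subseteq> carrier_vec n"
  shows "S_map n (n - 1) (pure_tensor n ws) [j] = det (mat_of_rows n (ws @ [unit_vec n j]))"
proof -
  \<comment> \<open>Subtraction is truncated, so this would fail for \<open>n = 0\<close>.\<close>
  have 1: "n - (n - 1) = 1" using assms by simp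
  have "[j] \<in> multi_idx n 1" using assms by (simp add: multi_idx_def)
  then show ?thesis
    using assms by (subst S_map_pure) (simp_all add: 1 sum_basis_tensor)
qed

text \<open>Deleting row \<open>i\<close> erases the difference between the two matrices, and
  Laplace expansion along that row keeps a single cofactor. Replacing a row suits
  \<open>R_map\<close>, which sends unit vectors to rows of \<open>A\<close>.\<close>

lemma adj_mat_eq_det_replace_row:
  assumes A: "(A :: 'a :: comm_ring_1 mat) \<in> carrier_mat n n" and i: "i < n" and j: "j < n"
  shows "adj_mat A $$ (j, i)
    = det (mat n n (\<lambda>(r, c). if r = i then unit_vec n j $ c else A $$ (r, c)))"
    (is "_ = det ?C")
proof -
  have C: "?C \<in> carrier_mat n n" by simp
  have "mat_delete ?C i c = mat_delete A i c" for c
    using A i by (intro eq_matI) (auto simp: mat_delete_def)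
  then have "det ?C = (\<Sum>c<n. unit_vec n j $ c * cofactor A i c)"
    using laplace_expansion_row[OF C i] A i by (simp add: cofactor_def)
  also have "\<dots> = (\<Sum>c<n. if c = j then cofactor A i c else 0)"
    using j by (intro sum.cong) (auto simp: unit_vec_def)
  finally show ?thesis using A i j by (simp add: adj_mat_def)
qed

text \<open>The sign of the enumeration \<open>is @ [i]\<close> occurs in both factors and cancels.
  All enumerations thus contribute equally, which reduces the final sum to counting.\<close>

lemma det_unit_rows_mult_det_image_rows:
  fixes A :: "'a :: comm_ring_1 mat"
  assumes A: "A \<in> carrier_mat n n" and i: "i < n" and j: "j < n"
    and len: "length is = n - 1" and lt: "set is \<subseteq> {..<n}"
  shows "det (mat_of_rows n (map (unit_vec n) (is @ [i])))
      * det (mat_of_rows n (map (row A) is @ [unit_vec n j]))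
    = (if distinct (is @ [i]) then adj_mat A $$ (j, i) else 0)"
proof -
  let ?e = "det (mat_of_rows n (map (unit_vec n) (is @ [i]))) :: 'a"
  define C where "C = mat n n (\<lambda>(r, c). if r = i then unit_vec n j $ c else A $$ (r, c))"
  show ?thesis
  proof (cases "distinct (is @ [i])")
    case True
    have "row C l = row A l" if "l \<in> set is" for l
      using that True A lt by (intro eq_vecI) (auto simp: C_def)
    moreover have "row C i = unit_vec n j"
      using i by (intro eq_vecI) (auto simp: C_def)
    ultimately have rows: "map (row A) is @ [unit_vec n j] = map (row C) (is @ [i])"
      by simp
    have "det (mat_of_rows n (map (row A) is @ [unit_vec n j])) = ?e * det C"
      unfolding rows using i len lt by (intro det_mat_of_rows_select) (auto simp: C_def)
    moreover have "?e * ?e = 1"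
      using det_mat_of_rows_unit_vec_square[of "is @ [i]" n] i len lt True
      by (simp add: power2_eq_square)
    ultimately show ?thesis
      using True by (simp add: adj_mat_eq_det_replace_row[OF A i j] C_def flip: mult.assoc)
  next
    case False
    then have "?e = 0"
      using i len by (intro det_mat_of_rows_unit_vec_not_distinct) auto
    with False show ?thesis by auto
  qed
qed

theorem proposition6p4:
  fixes n i j :: nat and A :: "complex mat"
  assumes "n \<ge> 1" and "A \<in> carrier_mat n n" and "i < n" and "j < n"
  shows "adj_mat A $$ (j, i) =
    (- 1) ^ (n div 2) / fact (n - 1) *
    vec_of_tensor n
      ((S_map n (n - 1) \<circ> tensor_power_map n (n - 1) (R_map A) \<circ> T_map n 1)
        (pure_tensor n [unit_vec n i])) $ j"
proof -
  let ?t = "T_map n 1 (pure_tensor n [unit_vec n i])"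
  let ?I = "multi_idx n (n - 1)"
  let ?rows = "\<lambda>is. map (R_map A) (map (unit_vec n) is)"
  \<comment> \<open>By definition \<open>tensor_power_map\<close> yields a combination of pure
    tensors with the coordinates of \<open>?t\<close> as coefficients, so only linearity of
    \<open>S_map\<close> is needed here.\<close>
  have "S_map n (n - 1) (tensor_power_map n (n - 1) (R_map A) ?t) [j]
      = (\<Sum>is\<in>?I. ?t is * S_map n (n - 1) (pure_tensor n (?rows is)) [j])"
    unfolding tensor_power_map_def S_map_def linear_extension_sum[symmetric]
    by (simp add: linear_extension_def[of _ _ "\<lambda>vs. pure_tensor n (map (R_map A) vs)"])
  also have "\<dots> = (\<Sum>is\<in>?I. (- 1) ^ (n div 2)
      * (if distinct (is @ [i]) then adj_mat A $$ (j, i) else 0))"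
  proof (rule sum.cong[OF refl])
    fix "is" assume "is": "is \<in> ?I"
    then have len: "length is = n - 1" and lt: "set is \<subseteq> {..<n}"
      by (auto simp: multi_idx_def)
    have rows: "?rows is = map (row A) is"
      using assms lt by (auto simp: R_map_unit_vec)
    have "S_map n (n - 1) (pure_tensor n (?rows is)) [j]
        = det (mat_of_rows n (map (row A) is @ [unit_vec n j]))"
      unfolding rows[symmetric]
      using assms len by (intro S_map_pure_apply_singleton) (auto intro: R_map_carrier)
    then show "?t is * S_map n (n - 1) (pure_tensor n (?rows is)) [j]
        = (- 1) ^ (n div 2) * (if distinct (is @ [i]) then adj_mat A $$ (j, i) else 0)"
      by (simp only: T_map_1_unit_vec_apply[OF \<open>i < n\<close> "is"] mult.assoc
          det_unit_rows_mult_det_image_rows[OF assms(2-4) len lt])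
  qed
  also have "\<dots> = (- 1) ^ (n div 2) * (fact (n - 1) * adj_mat A $$ (j, i))"
    using card_enumerations_remove[OF \<open>i < n\<close>]
    by (simp add: sum.If_cases Int_def flip: sum_distrib_left del: distinct_append)
  \<comment> \<open>The sign is its own inverse, so the prefactor cancels both it and the
    factorial.\<close>
  finally show ?thesis
    using \<open>j < n\<close> by (simp add: vec_of_tensor_def flip: power_add mult_2)
qed

end
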